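(* Let $k\geqslant 1$, $n\in\mathbb{Z}_{\geqslant 0}$, let $\overrightarrow{m}=(m_1,\ldots,m_k)$ be a multi-index of non-negative integers with $m=m_1+\ldots+m_k\neq 0$, and suppose that $n\geqslant\max\{m_j:1\leqslant j\leqslant k\}$. Put $n_j=n+m-m_j$. Let ${\bf f^{ch1}}=(f^{ch1}_1,\ldots,f^{ch1}_k)$ be a system of functions $$f^{ch1}_j(x)=\frac{a^j_0}{2}+\sum_{l=1}^\infty a^j_lT_l(x),\qquad T_l(x)=\cos(l\arccos x),$$ with real coefficients, the series converging for all $x\in[-1,1]$, and let ${\bf f^1}=(f^1_1,\ldots,f^1_k)$, $f^1_j(z)=\frac{a^j_0}{2}+\sum_{l=1}^\infty a^j_lz^l$, be the associated system of power series. Suppose that: 1) there exist (algebraic) Hermite--Jacobi approximations $\widehat{\pi}_j(z;{\bf f^1})=\widehat{P}_j(z;{\bf f^1})/\widehat{Q}_m(z;{\bf f^1})$, $j=1,\ldots,k$, for the multi-index $(n,\overrightarrow{m})$ and the system ${\bf f^1}$; 2) each power series $f^1_j$ has radius of convergence $R^1_j>1$; 3) the rational fractions $\widehat{\pi}_j(z;{\bf f^1})$, $j=1,\ldots,k$, have no poles in $\overline{D}=\{z:|z|\leqslant 1\}$. Then there exist nonlinear Hermite--Chebyshev approximations of the first kind $\widehat{\pi}^{ch1}_j(x;{\bf f^{ch1}})=\widehat{P}^{ch1}_j(x;{\bf f^{ch1}})/\widehat{Q}^{ch1}_m(x;{\bf f^{ch1}})$, $j=1,\ldots,k$, for the multi-index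 $(n,\overrightarrow{m})$ and the system ${\bf f^{ch1}}$, and for their denominator and numerators the following representations are valid: $$\widehat{Q}^{ch1}_m(x;{\bf f^{ch1}})=\widehat{Q}_m(e^{i\arccos x};{\bf f^1})\cdot\overline{\widehat{Q}_m(e^{i\arccos x};{\bf f^1})},$$ $$\widehat{P}^{ch1}_j(x;{\bf f^{ch1}})=\mathrm{Re}\left\{\widehat{P}_j(e^{i\arccos x};{\bf f^1})\cdot\overline{\widehat{Q}_m(e^{i\arccos x};{\bf f^1})}\right\},$$ where the Hermite--Jacobi polynomials $\widehat{Q}_m(z;{\bf f^1})$, $\widehat{P}_j(z;{\bf f^1})$ coincide with Hermite--Pad\'e polynomials $Q_m(z;{\bf f^1})$, $P_j(z;{\bf f^1})$ and, in the case when the determinant $H_{n,\overrightarrow{m}}({\bf f^1})\neq 0$, are found (with a suitable choice of the normalizing factor) by the formulas $$\widehat{Q}_m(z;{\bf f^1})=D(n,\overrightarrow{m};z),\qquad \widehat{P}_j(z;{\bf f^1})=G_j(n,\overrightarrow{m};z),\quad j=1,\ldots,k,$$ where the determinants $D$ and $G_j$ are formed for the system ${\bf f}={\bf f^1}$.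
   Context: Throughout, $O(z^p)$ denotes a power series of the form $c_1z^p+c_2z^{p+1}+\ldots$, and $n_j=n+m-m_j$ with $m=m_1+\ldots+m_k$. Nonlinear Hermite--Chebyshev approximations of the first kind for $(n,\overrightarrow{m})$ and ${\bf f^{ch1}}$ are rational fractions $\widehat{P}^{ch1}_j(x)/\widehat{Q}^{ch1}_m(x)$, $j=1,\ldots,k$, with a common denominator, where the polynomials $\widehat{Q}^{ch1}_m$ (not identically zero) and $\widehat{P}^{ch1}_j$, of degrees at most $m$ and $n_j$ respectively, are such that $$f^{ch1}_j(x)-\frac{\widehat{P}^{ch1}_j(x)}{\widehat{Q}^{ch1}_m(x)}=\sum_{l=n+m+1}^\infty\widehat{a}^j_lT_l(x),\quad j=1,\ldots,k\quad(x\in[-1,1]).$$ (Algebraic) Hermite--Jacobi approximations. For a system ${\bf f}=(f_1,\ldots,f_k)$ of power series $f_j(z)=\sum_{l=0}^\infty f^j_lz^l$, rational functions $\widehat{P}_j(z;{\bf f})/\widehat{Q}_m(z;{\bf f})$, $j=1,\ldots,k$, with a common denominator, where $\widehat{Q}_m$ (not identically zero) and $\widehat{P}_j$ are polynomials of degree at most $m$ and $n_j$ respectively (the Hermite--Jacobi polynomials), are called Hermite--Jacobi approximations for $(n,\overrightarrow{m})$ and ${\bf f}$ if $f_j(z)-\widehat{P}_j(z;{\bf f})/\widehat{Q}_m(z;{\bf f})=O(z^{n+m+1})$ for $j=1,\ldots,k$. When the coefficients of the series are real, $\widehat{Q}_m,\widehat{P}_j$ are taken with real coefficients. Hermite--Pad\'e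 polynomials for $(n,\overrightarrow{m})$ and ${\bf f}$ are polynomials $Q_m(z;{\bf f})\not\equiv 0$, $\deg Q_m\leqslant m$, and $P_j(z;{\bf f})$, $\deg P_j\leqslant n_j$, such that $Q_m(z;{\bf f})f_j(z)-P_j(z;{\bf f})=O(z^{n+m+1})$ for $j=1,\ldots,k$. Determinants. Put $f^j_p=0$ for $p<0$. For $m_j\neq 0$ let $H^j$ be the $m_j\times m$ matrix whose $r$-th row ($1\leqslant r\leqslant m_j$) is $(f^j_{n-m_j+r},f^j_{n-m_j+r+1},\ldots,f^j_{n_j+r-1})$, and let $F^j$ be the $m_j\times(m+1)$ matrix whose $r$-th row is $(f^j_{n-m_j+r},f^j_{n-m_j+r+1},\ldots,f^j_{n_j+r})$. Let $H_{n,\overrightarrow{m}}({\bf f})$ be the determinant of the $m\times m$ matrix obtained by placing $H^1,\ldots,H^k$ one above the other in this order, and let $F_{n,\overrightarrow{m}}({\bf f})$ be the $m\times(m+1)$ matrix obtained by placing $F^1,\ldots,F^k$ one above the other in this order; blocks with $m_j=0$ are omitted. Define the rows of length $m+1$ $$E(z)=(z^m,\ z^{m-1},\ \ldots,\ z,\ 1),$$ $$E_{m_j}(z)=\Big(\sum_{l=0}^{n-m_j}f^j_lz^{m+l},\ \sum_{l=0}^{n-m_j+1}f^j_lz^{m+l-1},\ \ldots,\ \sum_{l=0}^{n_j}f^j_lz^l\Big).$$ $D(n,\overrightarrow{m};z)$ and $G_j(n,\overrightarrow{m};z)$ denote the determinants of the square matrices obtained from $F_{n,\overrightarrow{m}}({\bf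 f})$ by adding, as the last row, $E(z)$ and $E_{m_j}(z)$ respectively. Quotients are regarded as rational functions, i.e. removable singularities are removed. The representations of $\widehat{Q}^{ch1}_m$, $\widehat{P}^{ch1}_j$ are for $x\in[-1,1]$ and determine these polynomials. *)

theory Defs
  imports
    "HOL-Complex_Analysis.Complex_Analysis"
    "Jordan_Normal_Form.Determinant"
begin

(* A multi-index (m_1, ..., m_k) is a function m :: nat => nat restricted to {1..k};
   systems of functions, series and polynomials are indexed in the same way. *)

definition msum :: "nat \<Rightarrow> (nat \<Rightarrow> nat) \<Rightarrow> nat" where
  "msum k m = (\<Sum>j=1..k. m j)"

definition num_deg :: "nat \<Rightarrow> nat \<Rightarrow> (nat \<Rightarrow> nat) \<Rightarrow> nat \<Rightarrow> nat" where
  "num_deg k n m j = n + msum k m - m j"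

subsection \<open>Chebyshev series\<close>

definition cheb_T :: "nat \<Rightarrow> real \<Rightarrow> real" where
  "cheb_T l x = cos (real l * arccos x)"

definition cheb_series :: "(nat \<Rightarrow> real) \<Rightarrow> real \<Rightarrow> real" where
  "cheb_series a x = a 0 / 2 + (\<Sum>l. a (Suc l) * cheb_T (Suc l) x)"

definition assoc_fps :: "(nat \<Rightarrow> real) \<Rightarrow> real fps" where
  "assoc_fps a = Abs_fps (\<lambda>l. if l = 0 then a 0 / 2 else a l)"

(* The value at x of the rational function p/q is the limit of the pointwise quotient, so
   removable singularities are removed; there is no value at a pole. *)
definition ratfun_value :: "real poly \<Rightarrow> real poly \<Rightarrow> real \<Rightarrow> real \<Rightarrow> bool" where
  "ratfun_value p q x y \<longleftrightarrow> ((\<lambda>t. poly p t / poly q t) \<longlongrightarrow> y) (at x)"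

definition nonlinear_hermite_chebyshev ::
  "nat \<Rightarrow> nat \<Rightarrow> (nat \<Rightarrow> nat) \<Rightarrow> (nat \<Rightarrow> real \<Rightarrow> real) \<Rightarrow> (nat \<Rightarrow> real poly) \<Rightarrow> real poly \<Rightarrow> bool" where
  "nonlinear_hermite_chebyshev k n m f P Q \<longleftrightarrow>
     Q \<noteq> 0 \<and> degree Q \<le> msum k m \<and>
     (\<forall>j\<in>{1..k}. degree (P j) \<le> num_deg k n m j \<and>
       (\<exists>b :: nat \<Rightarrow> real. \<forall>x\<in>{-1..1}. \<exists>y. ratfun_value (P j) Q x y \<and>
          (\<lambda>l. b (n + msum k m + 1 + l) * cheb_T (n + msum k m + 1 + l) x) sums (f j x - y)))"

subsection \<open>Hermite--Jacobi and Hermite--Pade polynomials\<close>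

definition is_O_pow :: "'a::field fls \<Rightarrow> nat \<Rightarrow> bool" where
  "is_O_pow g p \<longleftrightarrow> (\<exists>h. g = fps_to_fls (fps_X ^ p * h))"

(* The division is that of the field of formal Laurent series, so it yields the Laurent expansion
   at 0 of the rational function P_j/Q, also if Q vanishes at 0. *)
definition hermite_jacobi ::
  "nat \<Rightarrow> nat \<Rightarrow> (nat \<Rightarrow> nat) \<Rightarrow> (nat \<Rightarrow> 'a::field fps) \<Rightarrow> (nat \<Rightarrow> 'a poly) \<Rightarrow> 'a poly \<Rightarrow> bool" where
  "hermite_jacobi k n m f P Q \<longleftrightarrow>
     Q \<noteq> 0 \<and> degree Q \<le> msum k m \<and>
     (\<forall>j\<in>{1..k}. degree (P j) \<le> num_deg k n m j \<and>
       is_O_pow (fps_to_fls (f j) - fps_to_fls (fps_of_poly (P j)) / fps_to_fls (fps_of_poly Q))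
         (n + msum k m + 1))"

definition hermite_pade ::
  "nat \<Rightarrow> nat \<Rightarrow> (nat \<Rightarrow> nat) \<Rightarrow> (nat \<Rightarrow> 'a::field fps) \<Rightarrow> (nat \<Rightarrow> 'a poly) \<Rightarrow> 'a poly \<Rightarrow> bool" where
  "hermite_pade k n m f P Q \<longleftrightarrow>
     Q \<noteq> 0 \<and> degree Q \<le> msum k m \<and>
     (\<forall>j\<in>{1..k}. degree (P j) \<le> num_deg k n m j \<and>
       is_O_pow (fps_to_fls (fps_of_poly Q * f j - fps_of_poly (P j))) (n + msum k m + 1))"

(* Zeros of numerator and denominator that cancel are not poles: is_pole is defined by a limit. *)
definition ratfun_pole :: "real poly \<Rightarrow> real poly \<Rightarrow> complex \<Rightarrow> bool" where
  "ratfun_pole p q z \<longleftrightarrow>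
     is_pole (\<lambda>w. poly (map_poly complex_of_real p) w / poly (map_poly complex_of_real q) w) z"

subsection \<open>Determinants\<close>

(* The rows of the j-th block, truncated to c columns: c = m gives H^j, and c = m + 1 gives F^j.
   Rows and columns are numbered from 0. Coefficients with a negative index vanish, since
   those of fps_to_fls do. *)
definition block_rows ::
  "nat \<Rightarrow> nat \<Rightarrow> (nat \<Rightarrow> nat) \<Rightarrow> (nat \<Rightarrow> 'a::field fps) \<Rightarrow> nat \<Rightarrow> 'a Matrix.vec list" where
  "block_rows c n m f j =
     map (\<lambda>r. Matrix.vec c (\<lambda>i. fls_nth (fps_to_fls (f j)) (int n - int (m j) + int (r + 1) + int i)))
       [0..<m j]"

definition stacked_rows ::
  "nat \<Rightarrow> nat \<Rightarrow> nat \<Rightarrow> (nat \<Rightarrow> nat) \<Rightarrow> (nat \<Rightarrow> 'a::field fps) \<Rightarrow> 'a Matrix.vec list" where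
  "stacked_rows c k n m f = concat (map (block_rows c n m f) [1..<k + 1])"

definition det_H :: "nat \<Rightarrow> nat \<Rightarrow> (nat \<Rightarrow> nat) \<Rightarrow> (nat \<Rightarrow> 'a::field fps) \<Rightarrow> 'a" where
  "det_H k n m f = Determinant.det (mat_of_rows (msum k m) (stacked_rows (msum k m) k n m f))"

definition bordered_det ::
  "nat \<Rightarrow> nat \<Rightarrow> (nat \<Rightarrow> nat) \<Rightarrow> (nat \<Rightarrow> 'a::field fps) \<Rightarrow> 'a poly Matrix.vec \<Rightarrow> 'a poly" where
  "bordered_det k n m f v = Determinant.det (mat_of_rows (msum k m + 1)
     (map (map_vec (\<lambda>c. [:c:])) (stacked_rows (msum k m + 1) k n m f) @ [v]))"

definition E_row :: "nat \<Rightarrow> (nat \<Rightarrow> nat) \<Rightarrow> 'a::field poly Matrix.vec" where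
  "E_row k m = Matrix.vec (msum k m + 1) (\<lambda>i. Polynomial.monom 1 (msum k m - i))"

(* The condition l + m j <= n + i says l <= n - m_j + i without truncated subtraction. *)
definition E_num_row ::
  "nat \<Rightarrow> nat \<Rightarrow> (nat \<Rightarrow> nat) \<Rightarrow> (nat \<Rightarrow> 'a::field fps) \<Rightarrow> nat \<Rightarrow> 'a poly Matrix.vec" where
  "E_num_row k n m f j = Matrix.vec (msum k m + 1)
     (\<lambda>i. \<Sum>l | l + m j \<le> n + i. Polynomial.monom (fps_nth (f j) l) (msum k m - i + l))"

definition det_D :: "nat \<Rightarrow> nat \<Rightarrow> (nat \<Rightarrow> nat) \<Rightarrow> (nat \<Rightarrow> 'a::field fps) \<Rightarrow> 'a poly" where
  "det_D k n m f = bordered_det k n m f (E_row k m)"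

definition det_G :: "nat \<Rightarrow> nat \<Rightarrow> (nat \<Rightarrow> nat) \<Rightarrow> (nat \<Rightarrow> 'a::field fps) \<Rightarrow> nat \<Rightarrow> 'a poly" where
  "det_G k n m f j = bordered_det k n m f (E_num_row k n m f j)"

end

theory Submission
  imports Defs "HOL-Computational_Algebra.Field_as_Ring"
begin

text \<open>On the unit circle \<open>z = exp (\<i> t)\<close> with \<open>x = cos t\<close>, taking real parts turns a power series with real
  coefficients into the Chebyshev series with the same coefficients, because the real part of
  \<open>z ^ l\<close> is \<open>cos (l t) = T\<^sub>l x\<close>. The whole transfer from the algebraic to the Chebyshev problem rests
  on this. If \<open>P\<^sub>j/Q\<close> has no pole in the closed disc, its Taylor series converges on the unit circle,
  and so does that of the error \<open>f\<^sub>j - P\<^sub>j/Q = O(z ^ (n + m + 1))\<close>. The real part of the error is then a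
  Chebyshev series that starts at \<open>T\<^sub>l\<close> with \<open>l = n + m + 1\<close>, and the real part of \<open>P\<^sub>j/Q\<close> is the quotient of
  \<open>Re (P\<^sub>j cnj Q)\<close> by \<open>Q cnj Q\<close>. Both of these are polynomials in \<open>x\<close>: a product \<open>z ^ s cnj (z ^ t)\<close> has
  real part \<open>T\<^sub>l x\<close> with \<open>l = \<bar>s - t\<bar>\<close> (\<open>poly_re_product\<close>). The numerator therefore has degree at most
  \<open>max (deg P\<^sub>j) (deg Q)\<close>, which \<open>n\<^sub>j\<close> bounds because \<open>n \<ge> m\<^sub>j\<close> gives \<open>m \<le> n\<^sub>j\<close>. The expansion of the error
  is \<open>chebyshev_expansion_of_error\<close>.

  The absence of poles does not prevent \<open>Q\<close> from vanishing in the disc, even on the unit circle, where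
  a zero of \<open>Q\<close> may cancel against one of \<open>P\<^sub>j\<close>. The factor \<open>g = gcd P\<^sub>j Q\<close> is therefore split off. It
  contributes the same factor \<open>g cnj g\<close> to the numerator and the denominator of the Chebyshev fraction
  (\<open>re_product_cancel\<close>), and the remaining denominator has no zeros in the closed disc
  (\<open>no_pole_imp_denominator_nonzero\<close>).

  For the determinants, multiplying \<open>f\<^sub>j - P\<^sub>j/Q\<close> by \<open>Q\<close> shows that \<open>Q\<close> and \<open>P\<^sub>j\<close> are Hermite--Pade polynomials.
  The coefficients of \<open>Q f\<^sub>j\<close> strictly above \<open>n\<^sub>j\<close> and up to \<open>n + m\<close> vanish, which says that the
  coefficient vector \<open>q\<close> of \<open>Q\<close> is annihilated by the rows of \<open>F\<close>. Pairing \<open>q\<close> with the bordering rows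
  \<open>E\<close> and \<open>E\<^bsub>m_j\<^esub>\<close> gives \<open>Q\<close> and \<open>P\<^sub>j\<close>. Hence each bordered matrix maps \<open>q\<close> to a vector supported in its last
  entry, and Cramer's rule for the last unknown yields \<open>Q(0) D = H Q\<close> and \<open>Q(0) G\<^sub>j = H P\<^sub>j\<close> at once
  (\<open>bordered_det_Cramer\<close>).\<close>

no_notation fps_nth (infixl \<open>$\<close> 75)
no_notation vec_nth (infixl \<open>$\<close> 90)

section \<open>Products on the unit circle as polynomials in the cosine\<close>

fun cheb_poly :: "nat \<Rightarrow> real poly" where
  "cheb_poly 0 = 1"
| "cheb_poly (Suc 0) = [:0, 1:]"
| "cheb_poly (Suc (Suc l)) = [:0, 2:] * cheb_poly (Suc l) - cheb_poly l"

lemma degree_cheb_poly: "degree (cheb_poly l) \<le> l"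
proof (induction l rule: cheb_poly.induct)
  case (3 l)
  have "degree ([:0, 2:] * cheb_poly (Suc l)) \<le> Suc (Suc l)"
    using degree_mult_le[of "[:0, 2:]" "cheb_poly (Suc l)"] 3(1) by simp
  then show ?case
    using 3(2) by (auto intro!: degree_diff_le)
qed simp_all

lemma poly_cheb_poly_cos: "poly (cheb_poly l) (cos t) = cos (real l * t)"
proof (induction l rule: cheb_poly.induct)
  case (3 l)
  have "cos (real (Suc (Suc l)) * t) + cos (real l * t) = 2 * cos t * cos (real (Suc l) * t)"
    using cos_times_cos[of t "real (Suc l) * t"] cos_minus[of "real l * t"]
    by (simp add: algebra_simps)
  with 3 show ?case by (simp add: algebra_simps)
qed simp_all

abbreviation cpoly :: "real poly \<Rightarrow> complex \<Rightarrow> complex" where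
  "cpoly p \<equiv> poly (map_poly complex_of_real p)"

lemma cpoly_altdef: "cpoly p z = (\<Sum>i\<le>degree p. of_real (poly.coeff p i) * z ^ i)"
  by (simp add: poly_altdef degree_map_poly coeff_map_poly)

lemma cpoly_add: "cpoly (p + q) z = cpoly p z + cpoly q z"
  by (induction p q rule: poly_induct2) (auto simp: map_poly_pCons algebra_simps)

lemma cpoly_mult: "cpoly (p * q) z = cpoly p z * cpoly q z"
proof (induction p)
  case (pCons c p)
  have "cpoly (Polynomial.smult c q) z = of_real c * cpoly q z"
    by (simp add: map_poly_smult)
  with pCons show ?case
    by (simp add: cpoly_add map_poly_pCons algebra_simps)
qed simp

lemma cpoly_of_real: "cpoly p (of_real x) = of_real (poly p x)"
  unfolding cpoly_altdef by (simp add: poly_altdef)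

definition re_product :: "real poly \<Rightarrow> real poly \<Rightarrow> real poly" where
  "re_product p q = (\<Sum>s\<le>degree p. \<Sum>t\<le>degree q.
     Polynomial.smult (poly.coeff p s * poly.coeff q t) (cheb_poly (s - t + (t - s))))"

lemma degree_re_product: "degree (re_product p q) \<le> max (degree p) (degree q)"
  unfolding re_product_def
  by (intro degree_sum_le finite_atMost order_trans[OF degree_smult_le]
        order_trans[OF degree_cheb_poly]) auto

lemma Re_of_real_times: "Re (of_real c * w) = c * Re w"
  by simp

text \<open>The term \<open>p\<^sub>i q\<^sub>j z ^ i cnj (z ^ j)\<close> has real part \<open>p\<^sub>i q\<^sub>j cos ((i - j) t)\<close>, and the cosine is even. In
  \<open>re_product\<close> the distance of \<open>i\<close> and \<open>j\<close> is written \<open>i - j + (j - i)\<close>, where one of the truncated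
  differences is \<open>0\<close>.\<close>
lemma poly_re_product:
  "poly (re_product p q) (cos t) = Re (cpoly p (cis t) * cnj (cpoly q (cis t)))"
proof -
  have *: "Re (cis t ^ i * cnj (cis t) ^ j) = cos (real (i - j + (j - i)) * t)" for i j
  proof -
    have "Re (cis t ^ i * cnj (cis t) ^ j) = cos ((real i - real j) * t)"
      by (simp add: cis_cnj Complex.DeMoivre cis_mult algebra_simps)
    moreover have "\<dots> = cos (real (i - j + (j - i)) * t)"
      using cos_minus[of "(real i - real j) * t"]
      by (cases "i \<le> j") (auto simp: of_nat_diff algebra_simps)
    ultimately show ?thesis by simp
  qed
  have "Re (cpoly p (cis t) * cnj (cpoly q (cis t))) =
    (\<Sum>i\<le>degree p. \<Sum>j\<le>degree q. Re (of_real (poly.coeff p i * poly.coeff q j) * (cis t ^ i * cnj (cis t) ^ j)))"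
    unfolding cpoly_altdef cnj_sum sum_product Re_sum
    by (intro sum.cong refl) (simp add: algebra_simps)
  also have "\<dots> = (\<Sum>i\<le>degree p. \<Sum>j\<le>degree q. poly.coeff p i * poly.coeff q j * cos (real (i - j + (j - i)) * t))"
    by (simp only: Re_of_real_times *)
  also have "\<dots> = poly (re_product p q) (cos t)"
    by (simp add: re_product_def poly_sum poly_cheb_poly_cos)
  finally show ?thesis by simp
qed

lemma poly_eq_if_eq_on_cos:
  fixes p q :: "real poly"
  assumes "\<And>t. poly p (cos t) = poly q (cos t)"
  shows "p = q"
proof (rule ccontr)
  assume "p \<noteq> q"
  then have "finite {x. poly (p - q) x = 0}" by (intro poly_roots_finite) auto
  moreover have "{-1..1} \<subseteq> {x. poly (p - q) x = 0}"
  proof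
    fix x :: real
    assume "x \<in> {-1..1}"
    then show "x \<in> {x. poly (p - q) x = 0}" using assms[of "arccos x"] by simp
  qed
  ultimately have "finite {-1..1 :: real}" by (rule finite_subset[rotated])
  then show False using infinite_Icc[of "-1 :: real" 1] by simp
qed

text \<open>A common factor \<open>g\<close> contributes the real number \<open>g(z) cnj (g(z))\<close>, which can be pulled out of the real
  part.\<close>
lemma re_product_cancel:
  "re_product (g * a) (g * b) = re_product g g * re_product a b"
proof (rule poly_eq_if_eq_on_cos)
  fix t
  define G A B where "G = cpoly g (cis t)" and "A = cpoly a (cis t)" and "B = cpoly b (cis t)"
  have "G * A * cnj (G * B) = of_real (Re (G * cnj G)) * (A * cnj B)"
    by (simp add: complex_mult_cnj mult.assoc flip: complex_norm_square)
  then show "poly (re_product (g * a) (g * b)) (cos t) = poly (re_product g g * re_product a b) (cos t)"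
    by (simp only: poly_re_product cpoly_mult poly_mult G_def[symmetric] A_def[symmetric] B_def[symmetric]) simp
qed

lemma re_product_self_eq_0_iff: "poly (re_product p p) (cos t) = 0 \<longleftrightarrow> cpoly p (cis t) = 0"
  by (simp add: poly_re_product complex_mult_cnj complex_eq_iff sum_power2_eq_zero_iff)

text \<open>Otherwise \<open>p\<close> would vanish on the whole unit circle.\<close>
lemma re_product_self_neq_0:
  assumes "p \<noteq> 0"
  shows "re_product p p \<noteq> 0"
proof
  assume *: "re_product p p = 0"
  have "map_poly complex_of_real p \<noteq> 0"
    using assms by (simp add: poly_eq_iff coeff_map_poly)
  then have "finite {z. cpoly p z = 0}" by (rule poly_roots_finite)
  \<comment> \<open>The real parts of the points of the unit circle already fill an interval.\<close>
  then have "finite (Re ` {z. cpoly p z = 0})" by (rule finite_imageI)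
  moreover have "{-1..1} \<subseteq> Re ` {z. cpoly p z = 0}"
  proof
    fix x :: real
    assume "x \<in> {-1..1}"
    then have "x = Re (cis (arccos x))" by simp
    moreover have "cpoly p (cis (arccos x)) = 0"
      using re_product_self_eq_0_iff[of p "arccos x"] * by simp
    ultimately show "x \<in> Re ` {z. cpoly p z = 0}" by blast
  qed
  ultimately have "finite {-1..1 :: real}" by (rule finite_subset[rotated])
  then show False using infinite_Icc[of "-1 :: real" 1] by simp
qed

lemma eventually_poly_neq_0:
  fixes p :: "'a::{idom, real_normed_field} poly"
  assumes "p \<noteq> 0"
  shows "\<forall>\<^sub>F x in at a. poly p x \<noteq> 0"
  using poly_roots_finite[OF assms] islimpt_finite[of "{x. poly p x = 0}" a]
  by (simp add: islimpt_iff_eventually)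

text \<open>At a zero of \<open>g\<close> the two values are both \<open>0\<close>, but such points are isolated, so the limit does not see
  them.\<close>
lemma ratfun_value_cancel:
  assumes "g \<noteq> 0" "poly b x \<noteq> 0"
  shows "ratfun_value (g * a) (g * b) x (poly a x / poly b x)"
  unfolding ratfun_value_def
proof (rule Lim_transform_eventually)
  show "((\<lambda>t. poly a t / poly b t) \<longlongrightarrow> poly a x / poly b x) (at x)"
    using assms by (intro tendsto_intros) auto
  have "\<forall>\<^sub>F t in at x. poly g t \<noteq> 0"
    using assms(1) by (rule eventually_poly_neq_0)
  then show "\<forall>\<^sub>F t in at x. poly a t / poly b t = poly (g * a) t / poly (g * b) t"
    by eventually_elim auto
qed

section \<open>Taylor series of the quotient and of the error\<close>

text \<open>In lowest terms every complex zero of the denominator is a pole: Bezout's identity over the reals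
  also excludes common zeros at complex points.\<close>
lemma no_pole_imp_denominator_nonzero:
  fixes g a b :: "real poly"
  assumes "g \<noteq> 0" "b \<noteq> 0" "coprime a b" "\<not> ratfun_pole (g * a) (g * b) z"
  shows "cpoly b z \<noteq> 0"
proof
  assume bz: "cpoly b z = 0"
  define u v where "u = fst (bezout_coefficients a b)" and "v = snd (bezout_coefficients a b)"
  have "u * a + v * b = 1"
    using assms(3) by (simp add: u_def v_def bezout_coefficients_fst_snd)
  then have "cpoly (u * a + v * b) z = cpoly 1 z" by (simp only:)
  then have "cpoly u z * cpoly a z + cpoly v z * cpoly b z = 1"
    by (simp add: cpoly_add cpoly_mult)
  then have az: "cpoly a z \<noteq> 0" using bz by auto
  have ev: "\<forall>\<^sub>F w in at z. cpoly p w \<noteq> 0" if "p \<noteq> 0" for p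
    by (rule eventually_poly_neq_0) (use that in \<open>simp add: poly_eq_iff coeff_map_poly\<close>)
  have "(cpoly b \<longlongrightarrow> cpoly b z) (at z)" by (intro tendsto_intros)
  then have "filterlim (cpoly b) (at 0) (at z)"
    using bz ev[OF assms(2)] by (simp add: filterlim_at)
  then have "is_pole (\<lambda>w. cpoly a w / cpoly b w) z"
    using az by (intro is_pole_divide) auto
  moreover have "\<forall>\<^sub>F w in at z. cpoly a w / cpoly b w = cpoly (g * a) w / cpoly (g * b) w"
    using ev[OF assms(1)] by eventually_elim (auto simp: cpoly_mult)
  ultimately have "is_pole (\<lambda>w. cpoly (g * a) w / cpoly (g * b) w) z"
    using is_pole_cong[of "\<lambda>w. cpoly a w / cpoly b w" "\<lambda>w. cpoly (g * a) w / cpoly (g * b) w" z z] by simp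
  then show False using assms(4) by (simp add: ratfun_pole_def)
qed

text \<open>The series with the same coefficients over the complex numbers, so that it can be evaluated at points
  of the unit circle.\<close>
definition cfps :: "real fps \<Rightarrow> complex fps" where
  "cfps f = Abs_fps (\<lambda>l. of_real (fps_nth f l))"

lemma cfps_mult: "cfps (f * g) = cfps f * cfps g"
  by (simp add: cfps_def fps_eq_iff fps_mult_nth)

lemma cfps_diff: "cfps (f - g) = cfps f - cfps g"
  by (simp add: cfps_def fps_eq_iff)

lemma cfps_of_poly: "cfps (fps_of_poly p) = fps_of_poly (map_poly of_real p)"
  by (simp add: cfps_def fps_eq_iff coeff_map_poly)

lemma fps_conv_radius_cfps: "fps_conv_radius (cfps f) = fps_conv_radius f"
  by (simp add: fps_conv_radius_def conv_radius_def cfps_def)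

text \<open>The bridge between power series and cosine series: \<open>z ^ l\<close> has real part \<open>cos (l t)\<close> at \<open>z = cis t\<close>.\<close>
lemma Re_eval_cfps_sums:
  assumes "fps_conv_radius f > 1"
  shows "(\<lambda>l. fps_nth f l * cos (real l * t)) sums Re (eval_fps (cfps f) (cis t))"
proof -
  have "(\<lambda>l. fps_nth (cfps f) l * cis t ^ l) sums eval_fps (cfps f) (cis t)"
    using assms by (intro sums_eval_fps) (simp add: fps_conv_radius_cfps one_ereal_def)
  then have "(\<lambda>l. Re (fps_nth (cfps f) l * cis t ^ l)) sums Re (eval_fps (cfps f) (cis t))"
    by (rule sums_Re)
  then show ?thesis by (simp add: cfps_def Complex.DeMoivre)
qed

lemma cheb_series_eq_Re_eval:
  assumes "fps_conv_radius (assoc_fps c) > 1" "x \<in> {-1..1}"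
  shows "cheb_series c x = Re (eval_fps (cfps (assoc_fps c)) (cis (arccos x)))"
proof -
  let ?u = "\<lambda>l. fps_nth (assoc_fps c) l * cos (real l * arccos x)"
  have "(\<lambda>l. ?u (Suc l)) sums (Re (eval_fps (cfps (assoc_fps c)) (cis (arccos x))) - ?u 0)"
    by (subst sums_Suc_iff) (use Re_eval_cfps_sums[OF assms(1), of "arccos x"] in simp)
  moreover have "(\<lambda>l. ?u (Suc l)) = (\<lambda>l. c (Suc l) * cheb_T (Suc l) x)" "?u 0 = c 0 / 2"
    by (simp_all add: assoc_fps_def cheb_T_def)
  ultimately have "(\<lambda>l. c (Suc l) * cheb_T (Suc l) x) sums
      (Re (eval_fps (cfps (assoc_fps c)) (cis (arccos x))) - c 0 / 2)"
    by (simp only:)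
  then show ?thesis by (simp add: cheb_series_def sums_unique[symmetric])
qed

text \<open>A polynomial has finitely many zeros, so if \<open>b\<close> has none in the closed unit disc, it has none in some
  larger open disc either, and the Taylor series of \<open>1/b\<close> converges there.\<close>
lemma quotient_fps_past_unit_disc:
  assumes nz: "\<And>z. norm z \<le> 1 \<Longrightarrow> cpoly b z \<noteq> 0"
  obtains c where "fps_conv_radius c > 1" "fps_of_poly b * c = fps_of_poly a"
    "\<And>z. norm z \<le> 1 \<Longrightarrow> eval_fps (cfps c) z = cpoly a z / cpoly b z"
proof -
  have "map_poly complex_of_real b \<noteq> 0" using nz[of 0] by auto
  then have fin: "finite {z. cpoly b z = 0}" by (rule poly_roots_finite)
  obtain r :: real where r: "r > 1" "\<And>z. norm z < r \<Longrightarrow> cpoly b z \<noteq> 0"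
  proof -
    \<comment> \<open>The number 2 only keeps the set nonempty when \<open>b\<close> has no zeros at all.\<close>
    define r where "r = Min (insert 2 (norm ` {z. cpoly b z = 0}))"
    have "norm z > 1" if "cpoly b z = 0" for z using nz[of z] that by force
    then have "r > 1" using fin by (auto simp: r_def)
    moreover have "cpoly b z \<noteq> 0" if "norm z < r" for z
      using that fin by (auto simp: r_def)
    ultimately show thesis using that by blast
  qed
  define c where "c = fps_of_poly a * inverse (fps_of_poly b)"
  have "poly b 0 \<noteq> 0" using nz[of 0] cpoly_of_real[of b 0] by auto
  then have b0: "fps_nth (fps_of_poly b) 0 \<noteq> 0" by (simp add: poly_0_coeff_0)
  then have bc: "fps_of_poly b * c = fps_of_poly a"
    by (simp add: c_def inverse_mult_eq_1' mult.left_commute)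
  let ?B = "fps_of_poly (map_poly complex_of_real b)" and ?A = "fps_of_poly (map_poly complex_of_real a)"
  have BC: "?B * cfps c = ?A" using arg_cong[OF bc, of cfps] by (simp add: cfps_mult cfps_of_poly)
  have B0: "fps_nth ?B 0 \<noteq> 0" using b0 by (simp add: coeff_map_poly)
  have "cfps c = (inverse ?B * ?B) * cfps c"
    by (simp only: inverse_mult_eq_1[OF B0] mult_1_left)
  also have "\<dots> = ?A * inverse ?B"
    by (simp only: BC[symmetric] mult_ac)
  finally have c: "cfps c = ?A * inverse ?B" .
  have inv: "min (ereal r) (fps_conv_radius ?B) \<le> fps_conv_radius (inverse ?B)"
    using r by (intro fps_conv_radius_inverse) (auto simp: zero_ereal_def)
  then have "ereal r \<le> fps_conv_radius (inverse ?B)" by simp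
  moreover have "ereal r > 1" using r by (simp add: one_ereal_def)
  ultimately have rad: "fps_conv_radius (inverse ?B) > 1" by order
  have radc: "fps_conv_radius (cfps c) > 1"
    using fps_conv_radius_mult[of ?A "inverse ?B"] rad unfolding c by simp
  show thesis
  proof (rule that[OF _ bc])
    show "fps_conv_radius c > 1" using radc by (simp add: fps_conv_radius_cfps)
    fix z :: complex assume z: "norm z \<le> 1"
    then have z1: "ereal (norm z) < fps_conv_radius (inverse ?B)" using rad
      by (metis ereal_less_eq(3) one_ereal_def order_le_less_trans)
    have "eval_fps (inverse ?B) z = inverse (eval_fps ?B z)"
      by (rule eval_fps_inverse[where r = r]) (use r z in \<open>auto simp: zero_ereal_def\<close>)
    then show "eval_fps (cfps c) z = cpoly a z / cpoly b z"
      unfolding c using z1 by (subst eval_fps_mult) (auto simp: divide_inverse)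
  qed
qed


text \<open>The multiple of the power of \<open>X\<close> retains the factor \<open>q\<close>, so that dividing by a factor of \<open>q\<close>
  afterwards does not lower the order of vanishing, even if \<open>q\<close> vanishes at \<open>0\<close>.\<close>
lemma is_O_pow_clear_denominator:
  fixes f p q :: "'a::field fps"
  assumes "q \<noteq> 0" "is_O_pow (fps_to_fls f - fps_to_fls p / fps_to_fls q) N"
  obtains h where "q * f - p = fps_X ^ N * (q * h)"
proof -
  obtain h where h: "fps_to_fls f - fps_to_fls p / fps_to_fls q = fps_to_fls (fps_X ^ N * h)"
    using assms(2) by (auto simp: is_O_pow_def)
  have "fps_to_fls q * fps_to_fls f - fps_to_fls p = fps_to_fls q * (fps_to_fls f - fps_to_fls p / fps_to_fls q)"
    using assms(1) by (simp add: right_diff_distrib)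
  also have "\<dots> = fps_to_fls q * fps_to_fls (fps_X ^ N * h)" by (simp only: h)
  finally have "fps_to_fls (q * f - p) = fps_to_fls (q * (fps_X ^ N * h))"
    by (simp only: fls_times_fps_to_fls fps_to_fls_minus)
  then have "q * f - p = q * (fps_X ^ N * h)" by (simp only: fps_to_fls_eq_iff)
  then have "q * f - p = fps_X ^ N * (q * h)" by (simp add: mult_ac)
  then show thesis by (rule that)
qed

section \<open>From the power series error to the Chebyshev error\<close>

text \<open>The coefficients \<open>\<beta>\<close> are those of the power series error \<open>e = f - P/Q\<close>, where the Taylor series \<open>d\<close>
  of \<open>P/Q\<close> is obtained from the reduced fraction \<open>a/b\<close>.\<close>
lemma chebyshev_expansion_of_error:
  assumes Q: "Q \<noteq> 0"
    and approx: "is_O_pow (fps_to_fls (assoc_fps c) -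
      fps_to_fls (fps_of_poly P) / fps_to_fls (fps_of_poly Q)) N"
    and radius: "fps_conv_radius (assoc_fps c) > 1"
    and no_pole: "\<And>z. norm z \<le> 1 \<Longrightarrow> \<not> ratfun_pole P Q z"
  shows "\<exists>\<beta>. \<forall>x\<in>{-1..1}. \<exists>y. ratfun_value (re_product P Q) (re_product Q Q) x y \<and>
    (\<lambda>l. \<beta> (N + l) * cheb_T (N + l) x) sums (cheb_series c x - y)"
proof -
  define g where "g = gcd P Q"
  have "gcd P Q \<noteq> 0" using Q by simp
  then obtain a b where "P = a * g" "Q = b * g" and coprime: "coprime a b"
    unfolding g_def using gcd_coprime_exists by blast
  then have ab: "P = g * a" "Q = g * b" by (simp_all only: mult.commute)
  have gb: "g \<noteq> 0" "b \<noteq> 0" using ab Q by auto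
  have nz: "cpoly b z \<noteq> 0" if "norm z \<le> 1" for z
    using no_pole[OF that] no_pole_imp_denominator_nonzero[OF gb coprime] by (simp add: ab)
  obtain d where d: "fps_conv_radius d > 1" "fps_of_poly b * d = fps_of_poly a"
    "\<And>z. norm z \<le> 1 \<Longrightarrow> eval_fps (cfps d) z = cpoly a z / cpoly b z"
    using nz by (rule quotient_fps_past_unit_disc) blast+
  define e where "e = assoc_fps c - d"
  have Q_fps: "fps_of_poly Q \<noteq> 0" using Q by simp
  obtain h where h: "fps_of_poly Q * assoc_fps c - fps_of_poly P = fps_X ^ N * (fps_of_poly Q * h)"
    by (rule is_O_pow_clear_denominator[OF Q_fps approx])
  have "fps_of_poly Q * e = fps_of_poly Q * (fps_X ^ N * h)"
  proof -
    have "fps_of_poly Q * d = fps_of_poly P"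
      by (simp add: ab fps_of_poly_mult mult.assoc d(2))
    then show ?thesis using h by (simp add: e_def right_diff_distrib mult_ac)
  qed
  then have "e = fps_X ^ N * h" using Q by simp
  then have e_low: "fps_nth e l = 0" if "l < N" for l
    using that by (simp add: fps_X_power_mult_nth)
  have e_radius: "fps_conv_radius e > 1"
    unfolding e_def by (rule less_le_trans[OF _ fps_conv_radius_diff]) (use radius d(1) in simp)
  show ?thesis
  proof (intro exI[of _ "fps_nth e"] ballI)
    fix x :: real
    assume x: "x \<in> {-1..1}"
    define t where "t = arccos x"
    have xt: "x = cos t" using x by (simp add: t_def)
    define A B where "A = cpoly a (cis t)" and "B = cpoly b (cis t)"
    have B: "B \<noteq> 0" unfolding B_def by (rule nz) simp
    define y where "y = poly (re_product a b) x / poly (re_product b b) x"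
    \<comment> \<open>The value of the reduced Chebyshev fraction is the real part of the reduced fraction.\<close>
    have "y = Re (A * cnj B) / (norm B)\<^sup>2"
      by (simp add: y_def xt poly_re_product A_def B_def complex_mult_cnj cmod_power2)
    also have "\<dots> = Re (A / B)"
      by (subst complex_div_cnj) (simp flip: of_real_power)
    finally have y: "y = Re (A / B)" .
    have "poly (re_product b b) x \<noteq> 0"
      using B by (simp add: xt re_product_self_eq_0_iff B_def)
    then have "ratfun_value (re_product P Q) (re_product Q Q) x y"
      unfolding ab re_product_cancel y_def
      by (intro ratfun_value_cancel re_product_self_neq_0 gb)
    moreover have "(\<lambda>l. fps_nth e (N + l) * cheb_T (N + l) x) sums (cheb_series c x - y)"
    proof -
      have "1 < fps_conv_radius (cfps (assoc_fps c))" "1 < fps_conv_radius (cfps d)"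
        using radius d(1) by (simp_all add: fps_conv_radius_cfps)
      then have "eval_fps (cfps e) (cis t) = eval_fps (cfps (assoc_fps c)) (cis t) - A / B"
        unfolding e_def cfps_diff A_def B_def
        by (subst eval_fps_diff) (simp_all add: d(3) one_ereal_def)
      then have "Re (eval_fps (cfps e) (cis t)) = cheb_series c x - y"
        using cheb_series_eq_Re_eval[OF radius x] by (simp add: y t_def)
      then have "(\<lambda>l. fps_nth e l * cheb_T l x) sums (cheb_series c x - y)"
        using Re_eval_cfps_sums[OF e_radius, of t] by (simp add: cheb_T_def t_def)
      then show ?thesis
        using sums_iff_shift[of "\<lambda>l. fps_nth e l * cheb_T l x" N "cheb_series c x - y"]
        by (simp add: e_low add.commute[of N])
    qed
    ultimately show "\<exists>y. ratfun_value (re_product P Q) (re_product Q Q) x y \<and>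
      (\<lambda>l. fps_nth e (N + l) * cheb_T (N + l) x) sums (cheb_series c x - y)" by (intro exI conjI)
  qed
qed

lemma hermite_jacobi_imp_hermite_pade:
  assumes HJ: "hermite_jacobi k n m f P Q"
  shows "hermite_pade k n m f P Q"
proof -
  have Q: "Q \<noteq> 0" using HJ unfolding hermite_jacobi_def by (rule conjunct1)
  then have Q_fps: "fps_of_poly Q \<noteq> 0" by simp
  have "is_O_pow (fps_to_fls (fps_of_poly Q * g - fps_of_poly p)) N"
    if approx: "is_O_pow (fps_to_fls g - fps_to_fls (fps_of_poly p) / fps_to_fls (fps_of_poly Q)) N" for g p N
  proof -
    obtain h where h: "fps_of_poly Q * g - fps_of_poly p = fps_X ^ N * (fps_of_poly Q * h)"
      by (rule is_O_pow_clear_denominator[OF Q_fps approx])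
    show ?thesis unfolding is_O_pow_def h by (rule exI, rule refl)
  qed
  then show ?thesis using HJ unfolding hermite_jacobi_def hermite_pade_def by blast
qed

section \<open>Determinant formulas\<close>

lemma comm_ring_hom_const_poly: "comm_ring_hom (\<lambda>c :: 'a::comm_ring_1. [:c:])"
  by (unfold_locales, simp, simp, simp add: pCons_one, simp)

text \<open>The rows of the bordered matrix \<open>A\<close> other than \<open>v\<close> annihilate \<open>q\<close>, so \<open>A q\<close> is supported in the last entry,
  where it equals the pairing \<open>w\<close> of \<open>v\<close> with \<open>q\<close>. By Cramer's rule \<open>q\<^sub>M det A\<close> is the determinant of \<open>A\<close>
  with its last column replaced by \<open>A q\<close>, and expanding along that column leaves \<open>w\<close> times the minor
  of the unbordered rows without their last entries.\<close>
lemma bordered_det_Cramer: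
  fixes rs :: "'a::field Matrix.vec list" and v :: "'a poly Matrix.vec" and q :: "nat \<Rightarrow> 'a"
  assumes len: "length rs = M"
    and dim: "\<And>u. u \<in> set rs \<Longrightarrow> u \<in> carrier_vec (M + 1)"
    and ker: "\<And>u. u \<in> set rs \<Longrightarrow> (\<Sum>i\<le>M. u $ i * q i) = 0"
    and v: "v \<in> carrier_vec (M + 1)"
  shows "Polynomial.smult (q M) (Determinant.det (mat_of_rows (M + 1) (map (map_vec (\<lambda>c. [:c:])) rs @ [v]))) =
    Polynomial.smult (Determinant.det (mat_of_rows M (map (\<lambda>u. Matrix.vec M (\<lambda>i. u $ i)) rs)))
      (\<Sum>i\<le>M. Polynomial.smult (q i) (v $ i))"
proof -
  interpret const: comm_ring_hom "\<lambda>c :: 'a. [:c:]"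
    by (rule comm_ring_hom_const_poly)
  define A where "A = mat_of_rows (M + 1) (map (map_vec (\<lambda>c. [:c:])) rs @ [v])"
  define x where "x = Matrix.vec (M + 1) (\<lambda>i. [:q i:])"
  define H where "H = mat_of_rows M (map (\<lambda>u. Matrix.vec M (\<lambda>i. u $ i)) rs)"
  define w where "w = (\<Sum>i\<le>M. Polynomial.smult (q i) (v $ i))"
  have A: "A \<in> carrier_mat (M + 1) (M + 1)"
    unfolding A_def carrier_mat_def using len by (simp del: mat_of_rows_map)
  have x: "x \<in> carrier_vec (M + 1)" by (simp add: x_def)
  have A_entry: "A $$ (i, l) = (if i < M then [:rs ! i $ l:] else v $ l)" if "i < M + 1" "l < M + 1" for i l
    using that len dim[of "rs ! i"] by (auto simp: A_def mat_of_rows_index nth_append)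
  have Ax: "(A *\<^sub>v x) $ i = (if i = M then w else 0)" if "i < M + 1" for i
  proof -
    have "(A *\<^sub>v x) $ i = (\<Sum>l = 0..<M + 1. A $$ (i, l) * x $ l)"
      using A x that by (simp add: scalar_prod_def)
    also have "\<dots> = (\<Sum>l\<le>M. A $$ (i, l) * [:q l:])"
      by (intro sum.cong) (auto simp: x_def)
    also have "\<dots> = (if i = M then w else 0)"
    proof (cases "i = M")
      case True
      then show ?thesis using A_entry by (auto simp: w_def intro!: sum.cong)
    next
      case False
      with that have i: "i < M" by simp
      have "(\<Sum>l\<le>M. A $$ (i, l) * [:q l:]) = (\<Sum>l\<le>M. [:rs ! i $ l * q l:])"
        using A_entry i by (intro sum.cong) auto
      also have "\<dots> = [:\<Sum>l\<le>M. rs ! i $ l * q l:]"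
        by (rule const.hom_sum[symmetric])
      also have "\<dots> = 0" using ker[of "rs ! i"] i len by simp
      finally show ?thesis using False by simp
    qed
    finally show ?thesis .
  qed
  let ?R = "replace_col A (A *\<^sub>v x) M"
  have R: "?R \<in> carrier_mat (M + 1) (M + 1)" using A by (simp add: replace_col_def)
  have R_col: "?R $$ (i, M) = (if i = M then w else 0)" if "i < M + 1" for i
    using that A Ax by (simp add: replace_col_def)
  have "mat_delete ?R M M = map_mat (\<lambda>c. [:c:]) H"
    using A len dim A_entry
    by (intro eq_matI) (auto simp: mat_delete_def replace_col_def H_def mat_of_rows_index)
  then have cof: "cofactor ?R M M = [:Determinant.det H:]"
    by (simp add: cofactor_def)
  have "Determinant.det ?R = (\<Sum>i<M + 1. ?R $$ (i, M) * cofactor ?R i M)"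
    using R by (intro laplace_expansion_column) auto
  also have "\<dots> = (\<Sum>i<M + 1. if i = M then w * cofactor ?R i M else 0)"
    using R_col by (intro sum.cong) auto
  also have "\<dots> = Polynomial.smult (Determinant.det H) w"
    by (simp add: cof)
  finally show ?thesis
    using cramer_lemma_mat[OF A x, of M] by (simp add: x_def A_def H_def w_def)
qed

lemma length_stacked_rows: "length (stacked_rows c k n m f) = msum k m"
proof -
  have "length (stacked_rows c k n m f) = (\<Sum>j\<leftarrow>[1..<k + 1]. m j)"
    by (simp add: stacked_rows_def length_concat block_rows_def comp_def del: upt_Suc)
  also have "\<dots> = msum k m"
    by (simp only: sum_list_distinct_conv_sum_set distinct_upt set_upt msum_def
          atLeastLessThanSuc_atLeastAtMost flip: Suc_eq_plus1)
  finally show ?thesis .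
qed

text \<open>Deleting the last column of \<open>F\<close> gives the matrix of \<open>H\<close>; so \<open>H\<close> is the minor that appears in Cramer's
  rule.\<close>
lemma stacked_rows_truncate:
  "map (\<lambda>u. Matrix.vec c (\<lambda>i. u $ i)) (stacked_rows (c + 1) k n m f) = stacked_rows c k n m f"
  unfolding stacked_rows_def map_concat map_map
  by (intro arg_cong[of _ _ concat] map_cong refl) (auto simp: block_rows_def)

text \<open>A row of \<open>F\<close> is a window of \<open>M + 1\<close> consecutive coefficients of \<open>g\<close> ending at \<open>N\<close>. Against the coefficients of \<open>q\<close>
  in descending order it computes one coefficient of the product, since \<open>M \<le> N\<close> keeps the window
  inside the range of nonnegative indices.\<close>
lemma sum_coeff_eq_coeff_mult:
  fixes g :: "'a::field fps"
  assumes "degree q \<le> M" "M \<le> N"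
  shows "(\<Sum>i\<le>M. fps_nth g (N - M + i) * poly.coeff q (M - i)) = fps_nth (fps_of_poly q * g) N"
proof -
  have "fps_nth (fps_of_poly q * g) N = (\<Sum>s\<le>N. poly.coeff q s * fps_nth g (N - s))"
    by (simp add: fps_mult_nth atLeast0AtMost)
  also have "\<dots> = (\<Sum>s\<le>M. poly.coeff q s * fps_nth g (N - s))"
    using assms by (intro sum.mono_neutral_right) (auto simp: coeff_eq_0)
  also have "\<dots> = (\<Sum>i\<le>M. poly.coeff q (M - i) * fps_nth g (N - (M - i)))"
    by (rule sum.reindex_bij_witness[of _ "\<lambda>i. M - i" "\<lambda>i. M - i"]) auto
  also have "\<dots> = (\<Sum>i\<le>M. fps_nth g (N - M + i) * poly.coeff q (M - i))"
    using assms by (intro sum.cong) (auto simp: mult.commute)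
  finally show ?thesis by simp
qed

lemma fps_nth_eq_0_if_is_O_pow:
  assumes "is_O_pow (fps_to_fls g) N" "l < N"
  shows "fps_nth g l = 0"
  using assms by (auto simp: is_O_pow_def fps_X_power_mult_nth)

lemma m_le_msum: "j \<in> {1..k} \<Longrightarrow> m j \<le> msum k m"
  unfolding msum_def by (rule member_le_sum) auto

lemma hermite_pade_coeff:
  assumes hp: "hermite_pade k n m f P Q" and j: "j \<in> {1..k}"
    and p: "p \<le> n + msum k m"
  shows "fps_nth (fps_of_poly Q * f j) p = poly.coeff (P j) p"
  using fps_nth_eq_0_if_is_O_pow[of "fps_of_poly Q * f j - fps_of_poly (P j)" "n + msum k m + 1" p] hp j p
  by (simp add: hermite_pade_def)

text \<open>Row \<open>r\<close> (counted from \<open>0\<close>) of the block \<open>j\<close> yields the coefficient of \<open>Q f\<^sub>j\<close> at \<open>n\<^sub>j + r + 1\<close>. This index is at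
  most \<open>n + m\<close>, hence the coefficient agrees with that of \<open>P\<^sub>j\<close>, and it exceeds the degree of \<open>P\<^sub>j\<close>.\<close>
lemma stacked_rows_orthogonal_denominator:
  assumes hp: "hermite_pade k n m f P Q" and n: "\<And>j. j \<in> {1..k} \<Longrightarrow> m j \<le> n"
    and u: "u \<in> set (stacked_rows (msum k m + 1) k n m f)"
  shows "(\<Sum>i\<le>msum k m. u $ i * poly.coeff Q (msum k m - i)) = 0"
proof -
  let ?M = "msum k m"
  obtain j where j: "j \<in> {1..k}" and uj: "u \<in> set (block_rows (?M + 1) n m f j)"
    using u by (auto simp: stacked_rows_def less_Suc_eq_le simp del: upt_Suc)
  obtain r where r: "r < m j" and
    u_eq: "u = Matrix.vec (?M + 1) (\<lambda>i. fls_nth (fps_to_fls (f j)) (int n - int (m j) + int (r + 1) + int i))"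
    using uj by (auto simp: block_rows_def)
  let ?p = "num_deg k n m j + r + 1"
  note mj = n[OF j] m_le_msum[OF j, of m]
  have "u $ i = fps_nth (f j) (?p - ?M + i)" if "i \<le> ?M" for i
  proof -
    have index: "int n - int (m j) + int (r + 1) + int i = int (?p - ?M + i)"
      using mj by (simp add: num_deg_def)
    have "u $ i = fls_nth (fps_to_fls (f j)) (int n - int (m j) + int (r + 1) + int i)"
      using that by (simp add: u_eq)
    also have "\<dots> = fps_nth (f j) (?p - ?M + i)"
      by (simp only: index fps_to_fls_nth nat_int of_nat_less_0_iff if_False)
    finally show ?thesis .
  qed
  then have "(\<Sum>i\<le>?M. u $ i * poly.coeff Q (?M - i)) =
      (\<Sum>i\<le>?M. fps_nth (f j) (?p - ?M + i) * poly.coeff Q (?M - i))"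
    by simp
  also have "\<dots> = fps_nth (fps_of_poly Q * f j) ?p"
    using hp mj by (intro sum_coeff_eq_coeff_mult) (auto simp: hermite_pade_def num_deg_def)
  also have "\<dots> = poly.coeff (P j) ?p"
    using mj r by (intro hermite_pade_coeff[OF hp j]) (simp add: num_deg_def)
  also have "\<dots> = 0"
    using hp j by (intro coeff_eq_0) (auto simp: hermite_pade_def less_Suc_eq_le intro: trans_le_add1)
  finally show ?thesis .
qed

lemma E_row_combination:
  assumes "degree Q \<le> msum k m"
  shows "(\<Sum>i\<le>msum k m. Polynomial.smult (poly.coeff Q (msum k m - i)) (E_row k m $ i)) = Q"
proof -
  let ?M = "msum k m"
  have "(\<Sum>i\<le>?M. Polynomial.smult (poly.coeff Q (?M - i)) (E_row k m $ i)) =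
      (\<Sum>i\<le>?M. Polynomial.monom (poly.coeff Q (?M - i)) (?M - i))"
    by (intro sum.cong) (auto simp: E_row_def smult_monom)
  also have "\<dots> = (\<Sum>s\<le>?M. Polynomial.monom (poly.coeff Q s) s)"
    by (rule sum.reindex_bij_witness[of _ "\<lambda>i. ?M - i" "\<lambda>i. ?M - i"]) auto
  also have "\<dots> = Q" by (rule poly_as_sum_of_monoms'[OF assms])
  finally show ?thesis .
qed

text \<open>The entry of column \<open>i\<close> is \<open>z ^ (m - i) f\<^sub>j\<close> with the terms above degree \<open>n\<^sub>j\<close> cut off. The combination is
  therefore \<open>Q f\<^sub>j\<close> cut off above \<open>n\<^sub>j\<close>, which is \<open>P\<^sub>j\<close>.\<close>
lemma E_num_row_combination:
  assumes hp: "hermite_pade k n m f P Q" and j: "j \<in> {1..k}" and n: "m j \<le> n"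
  shows "(\<Sum>i\<le>msum k m. Polynomial.smult (poly.coeff Q (msum k m - i)) (E_num_row k n m f j $ i)) = P j"
proof (rule poly_eqI)
  let ?M = "msum k m"
  let ?g = "f j"
  have mj: "m j \<le> ?M" by (rule m_le_msum[OF j])
  have degQ: "degree Q \<le> ?M" and degP: "degree (P j) \<le> num_deg k n m j"
    using hp j by (auto simp: hermite_pade_def)
  fix p
  have row: "poly.coeff (E_num_row k n m f j $ i) p =
      (if p \<le> num_deg k n m j \<and> ?M - i \<le> p then fps_nth ?g (p - (?M - i)) else 0)" if "i \<le> ?M" for i
  proof -
    have fin: "finite {l. l + m j \<le> n + i}"
      by (rule finite_subset[of _ "{..n + i}"]) auto
    have "poly.coeff (E_num_row k n m f j $ i) p =
        (\<Sum>l | l + m j \<le> n + i. if ?M - i + l = p then fps_nth ?g l else 0)"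
      using that by (simp add: E_num_row_def coeff_sum)
    also have "\<dots> = (\<Sum>l | l + m j \<le> n + i. if l = p - (?M - i) then (if ?M - i \<le> p then fps_nth ?g l else 0) else 0)"
      by (intro sum.cong) auto
    also have "\<dots> = (if p - (?M - i) + m j \<le> n + i \<and> ?M - i \<le> p then fps_nth ?g (p - (?M - i)) else 0)"
      by (subst sum.delta[OF fin]) (simp only: mem_Collect_eq, metis)
    also have "p - (?M - i) + m j \<le> n + i \<and> ?M - i \<le> p \<longleftrightarrow> p \<le> num_deg k n m j \<and> ?M - i \<le> p"
      using that mj n by (auto simp: num_deg_def)
    finally show ?thesis .
  qed
  have "poly.coeff (\<Sum>i\<le>?M. Polynomial.smult (poly.coeff Q (?M - i)) (E_num_row k n m f j $ i)) p =
     (\<Sum>i\<le>?M. poly.coeff Q (?M - i) * (if p \<le> num_deg k n m j \<and> ?M - i \<le> p then fps_nth ?g (p - (?M - i)) else 0))"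
    unfolding coeff_sum by (intro sum.cong) (auto simp: row)
  also have "\<dots> = (\<Sum>s\<le>?M. poly.coeff Q s * (if p \<le> num_deg k n m j \<and> s \<le> p then fps_nth ?g (p - s) else 0))"
    by (rule sum.reindex_bij_witness[of _ "\<lambda>i. ?M - i" "\<lambda>i. ?M - i"]) auto
  also have "\<dots> = poly.coeff (P j) p"
  proof (cases "p \<le> num_deg k n m j")
    case True
    have "(\<Sum>s\<le>?M. poly.coeff Q s * (if p \<le> num_deg k n m j \<and> s \<le> p then fps_nth ?g (p - s) else 0)) =
        (\<Sum>s\<in>{..p} \<inter> {..?M}. poly.coeff Q s * fps_nth ?g (p - s))"
      using True by (intro sum.mono_neutral_cong_right) auto
    also have "\<dots> = (\<Sum>s\<le>p. poly.coeff Q s * fps_nth ?g (p - s))"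
      using degQ by (intro sum.mono_neutral_left) (auto simp: coeff_eq_0)
    also have "\<dots> = fps_nth (fps_of_poly Q * ?g) p"
      by (simp add: fps_mult_nth atLeast0AtMost)
    also have "\<dots> = poly.coeff (P j) p"
      using True by (intro hermite_pade_coeff[OF hp j]) (simp add: num_deg_def)
    finally show ?thesis .
  next
    case False
    then show ?thesis using degP by (simp add: coeff_eq_0)
  qed
  finally show "poly.coeff (\<Sum>i\<le>?M. Polynomial.smult (poly.coeff Q (?M - i)) (E_num_row k n m f j $ i)) p =
      poly.coeff (P j) p" .
qed

text \<open>The common factor is \<open>c = Q(0)/H\<close>. It is nonzero because \<open>Q(0) = 0\<close> would give \<open>H Q = Q(0) D = 0\<close>,
  against \<open>H \<noteq> 0\<close> and \<open>Q \<noteq> 0\<close>.\<close>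
lemma hermite_pade_determinant_formulas:
  fixes f :: "nat \<Rightarrow> 'a::field fps"
  assumes hp: "hermite_pade k n m f P Q" and n: "\<And>j. j \<in> {1..k} \<Longrightarrow> m j \<le> n"
    and H: "det_H k n m f \<noteq> 0"
  shows "\<exists>c. c \<noteq> 0 \<and> Q = Polynomial.smult c (det_D k n m f) \<and>
    (\<forall>j\<in>{1..k}. P j = Polynomial.smult c (det_G k n m f j))"
proof -
  let ?M = "msum k m"
  let ?H = "det_H k n m f"
  have rows: "u \<in> carrier_vec (?M + 1)" if "u \<in> set (stacked_rows (?M + 1) k n m f)" for u
    using that by (auto simp: stacked_rows_def block_rows_def simp del: upt_Suc)
  have Cramer: "Polynomial.smult (poly.coeff Q 0) (bordered_det k n m f v) =
      Polynomial.smult ?H (\<Sum>i\<le>?M. Polynomial.smult (poly.coeff Q (?M - i)) (v $ i))"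
    if "v \<in> carrier_vec (?M + 1)" for v
    using bordered_det_Cramer[OF length_stacked_rows rows stacked_rows_orthogonal_denominator[OF hp n] that]
    by (simp only: bordered_det_def det_H_def stacked_rows_truncate diff_self_eq_0)
  have Q: "Polynomial.smult (poly.coeff Q 0) (det_D k n m f) = Polynomial.smult ?H Q"
    using Cramer[of "E_row k m"] hp E_row_combination[of Q k m]
    by (simp add: det_D_def hermite_pade_def) (simp add: E_row_def)
  have P: "Polynomial.smult (poly.coeff Q 0) (det_G k n m f j) = Polynomial.smult ?H (P j)"
    if "j \<in> {1..k}" for j
    using Cramer[of "E_num_row k n m f j"] E_num_row_combination[OF hp that n[OF that]]
    by (simp add: det_G_def) (simp add: E_num_row_def)
  have solve: "x = Polynomial.smult (poly.coeff Q 0 / ?H) y"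
    if "Polynomial.smult (poly.coeff Q 0) y = Polynomial.smult ?H x" for x y
    using H arg_cong[OF that, of "Polynomial.smult (inverse ?H)"] by (simp add: divide_inverse mult.commute)
  have "poly.coeff Q 0 \<noteq> 0"
    using Q H hp by (auto simp: hermite_pade_def)
  then show ?thesis
    using solve[OF Q] solve[OF P] H by (intro exI[of _ "poly.coeff Q 0 / ?H"]) auto
qed

theorem theorem3:
  fixes k n :: nat and m :: "nat \<Rightarrow> nat" and a :: "nat \<Rightarrow> nat \<Rightarrow> real"
    and P :: "nat \<Rightarrow> real poly" and Q :: "real poly"
  assumes "k \<ge> 1"
    and "msum k m \<noteq> 0"
    and "n \<ge> Max (m ` {1..k})"
    and "\<And>j x. j \<in> {1..k} \<Longrightarrow> x \<in> {-1..1} \<Longrightarrow> summable (\<lambda>l. a j (Suc l) * cheb_T (Suc l) x)"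
    and "hermite_jacobi k n m (\<lambda>j. assoc_fps (a j)) P Q"
    and "\<And>j. j \<in> {1..k} \<Longrightarrow> fps_conv_radius (assoc_fps (a j)) > 1"
    and "\<And>j z. j \<in> {1..k} \<Longrightarrow> norm z \<le> 1 \<Longrightarrow> \<not> ratfun_pole (P j) Q z"
  shows
    "(\<exists>Pch Qch. nonlinear_hermite_chebyshev k n m (\<lambda>j. cheb_series (a j)) Pch Qch \<and>
       (\<forall>x\<in>{-1..1}.
          complex_of_real (poly Qch x) =
            poly (map_poly complex_of_real Q) (exp (\<i> * complex_of_real (arccos x))) *
            cnj (poly (map_poly complex_of_real Q) (exp (\<i> * complex_of_real (arccos x))))) \<and>
       (\<forall>j\<in>{1..k}. \<forall>x\<in>{-1..1}.
          poly (Pch j) x =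
            Re (poly (map_poly complex_of_real (P j)) (exp (\<i> * complex_of_real (arccos x))) *
                cnj (poly (map_poly complex_of_real Q) (exp (\<i> * complex_of_real (arccos x))))))) \<and>
     hermite_pade k n m (\<lambda>j. assoc_fps (a j)) P Q \<and>
     (det_H k n m (\<lambda>j. assoc_fps (a j)) \<noteq> 0 \<longrightarrow>
       (\<exists>c. c \<noteq> 0 \<and> Q = Polynomial.smult c (det_D k n m (\<lambda>j. assoc_fps (a j))) \<and>
         (\<forall>j\<in>{1..k}. P j = Polynomial.smult c (det_G k n m (\<lambda>j. assoc_fps (a j)) j))))"
proof -
  note HJ = assms(5) and radius = assms(6) and no_pole = assms(7)
  have n: "m j \<le> n" if "j \<in> {1..k}" for j
    using assms(3) that by (auto intro: order_trans[OF Max_ge])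
  have Q: "Q \<noteq> 0" "degree Q \<le> msum k m"
    using HJ unfolding hermite_jacobi_def by blast+
  have P: "degree (P j) \<le> num_deg k n m j"
      "is_O_pow (fps_to_fls (assoc_fps (a j)) - fps_to_fls (fps_of_poly (P j)) / fps_to_fls (fps_of_poly Q))
         (n + msum k m + 1)" if "j \<in> {1..k}" for j
    using HJ that unfolding hermite_jacobi_def by blast+
  have HP: "hermite_pade k n m (\<lambda>j. assoc_fps (a j)) P Q"
    using HJ by (rule hermite_jacobi_imp_hermite_pade)
  define Qch where "Qch = re_product Q Q"
  define Pch where "Pch = (\<lambda>j. re_product (P j) Q)"
  have "nonlinear_hermite_chebyshev k n m (\<lambda>j. cheb_series (a j)) Pch Qch"
    unfolding nonlinear_hermite_chebyshev_def
  proof (intro conjI ballI)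
    show "Qch \<noteq> 0" using Q(1) by (simp add: Qch_def re_product_self_neq_0)
    show "degree Qch \<le> msum k m"
      using degree_re_product[of Q Q] Q(2) by (simp add: Qch_def)
    fix j assume j: "j \<in> {1..k}"
    have "msum k m \<le> num_deg k n m j" using n[OF j] by (simp add: num_deg_def)
    then show "degree (Pch j) \<le> num_deg k n m j"
      using degree_re_product[of "P j" Q] Q(2) P(1)[OF j] by (simp add: Pch_def)
    show "\<exists>b. \<forall>x\<in>{-1..1}. \<exists>y. ratfun_value (Pch j) Qch x y \<and>
        (\<lambda>l. b (n + msum k m + 1 + l) * cheb_T (n + msum k m + 1 + l) x) sums (cheb_series (a j) x - y)"
      unfolding Pch_def Qch_def
      by (rule chebyshev_expansion_of_error[OF Q(1) P(2)[OF j] radius[OF j] no_pole[OF j]])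
  qed
  moreover have "complex_of_real (poly Qch x) =
      cpoly Q (exp (\<i> * complex_of_real (arccos x))) * cnj (cpoly Q (exp (\<i> * complex_of_real (arccos x))))"
    if "x \<in> {-1..1}" for x
    using that poly_re_product[of Q Q "arccos x"]
    by (simp add: Qch_def cis_conv_exp complex_eq_iff)
  moreover have "poly (Pch j) x = Re (cpoly (P j) (exp (\<i> * complex_of_real (arccos x))) *
      cnj (cpoly Q (exp (\<i> * complex_of_real (arccos x)))))"
    if "x \<in> {-1..1}" for j x
    using that poly_re_product[of "P j" Q "arccos x"]
    by (simp add: Pch_def cis_conv_exp)
  ultimately show ?thesis
    using HP hermite_pade_determinant_formulas[OF HP n] by blast
qed

end
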